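(* Suppose $\alpha\le\frac{2\delta}{\mu}<\beta$ and $M\ge M_\beta$. Then the function $$V(x)=\begin{cases}V'(0)\,\dfrac{\mu a(x)-2\delta}{2\gamma}\left(\dfrac{a(x)-c}{2\delta/\mu-c}\right)^{-\Gamma}, & 0\le x<x_\beta,\\[1mm] K_1(\beta)e^{r_+(\beta)(x-x_1)}+K_2(\beta)e^{r_-(\beta)(x-x_1)}, & x_\beta\le x<x_1,\\[1mm] \dfrac{M}{\gamma}+\dfrac{1}{\tilde r_-(\beta)}e^{\tilde r_-(\beta)(x-x_1)}, & x\ge x_1,\end{cases}$$ (with all quantities as defined in the context) is a concave, twice continuously differentiable solution on $[0,\infty)$ of the HJB equation $$0=\max_{\alpha\le a\le\beta}\left(\tfrac12\sigma^2a^2V''(x)+(a\mu-\delta)V'(x)-\gamma V(x)+M(1-V'(x))^+\right),\qquad V(0)=0,$$ and it satisfies $0\le V(x)\le\frac{M}{\gamma}$ for all $x>0$.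
   Context: Parameters: real constants $\mu>0$, $\sigma>0$, $\gamma>0$, $\delta\ge0$, $M>0$, $0<\alpha<\beta<\infty$; $y^+=\max(y,0)$. $r_\pm(\beta)=\dfrac{-(\beta\mu-\delta)\pm\sqrt{(\beta\mu-\delta)^2+2\gamma\sigma^2\beta^2}}{\sigma^2\beta^2}$, $\quad\tilde r_-(\beta)=\dfrac{-(\beta\mu-\delta-M)-\sqrt{(\beta\mu-\delta-M)^2+2\gamma\sigma^2\beta^2}}{\sigma^2\beta^2}$. $c=\dfrac{2\delta\mu}{\mu^2+2\gamma\sigma^2}$, $\Gamma=\dfrac{\mu^2}{\mu^2+2\gamma\sigma^2}$, $M_\beta=(\beta-c)\dfrac{\mu^2+2\gamma\sigma^2}{2\mu}$, and $G(u)=u+c\log(u-c)$ for $u>c$, with $G^{-1}$ its inverse. $x_\beta=\dfrac{\mu\sigma^2}{\mu^2+2\gamma\sigma^2}\left[G(\beta)-G\left(\dfrac{2\delta}{\mu}\right)\right]$, $\quad a(x)=G^{-1}\left(\dfrac{\mu^2+2\gamma\sigma^2}{\mu\sigma^2}x+G\left(\dfrac{2\delta}{\mu}\right)\right)$ for $x\ge0$. $K_1(\beta)=\dfrac{\tilde r_-(\beta)-r_-(\beta)}{r_+(\beta)(r_+(\beta)-r_-(\beta))}$, $\quad K_2(\beta)=\dfrac{r_+(\beta)-\tilde r_-(\beta)}{r_-(\beta)(r_+(\beta)-r_-(\beta))}$. $\Delta=\dfrac{1}{r_+(\beta)-r_-(\beta)}\log\left(-\dfrac{(r_+(\beta)-\tilde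 r_-(\beta))(\mu+\beta\sigma^2r_-(\beta))}{(\tilde r_-(\beta)-r_-(\beta))(\mu+\beta\sigma^2r_+(\beta))}\right)$, and $x_1=x_\beta-\Delta$. The constant written $V'(0)$ is defined by $V'(0)=\dfrac{2\gamma}{\mu\beta-2\delta}\left(\dfrac{\beta-c}{2\delta/\mu-c}\right)^{\Gamma}\left(K_1(\beta)e^{r_+(\beta)\Delta}+K_2(\beta)e^{r_-(\beta)\Delta}\right)$. *)

theory Defs
  imports "HOL-Analysis.Analysis"
begin

definition r_plus :: "real \<Rightarrow> real \<Rightarrow> real \<Rightarrow> real \<Rightarrow> real \<Rightarrow> real" where
  "r_plus \<mu> \<sigma> \<gamma> \<delta> \<beta> =
     (- (\<beta> * \<mu> - \<delta>) + sqrt ((\<beta> * \<mu> - \<delta>)\<^sup>2 + 2 * \<gamma> * \<sigma>\<^sup>2 * \<beta>\<^sup>2)) / (\<sigma>\<^sup>2 * \<beta>\<^sup>2)"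

definition r_minus :: "real \<Rightarrow> real \<Rightarrow> real \<Rightarrow> real \<Rightarrow> real \<Rightarrow> real" where
  "r_minus \<mu> \<sigma> \<gamma> \<delta> \<beta> =
     (- (\<beta> * \<mu> - \<delta>) - sqrt ((\<beta> * \<mu> - \<delta>)\<^sup>2 + 2 * \<gamma> * \<sigma>\<^sup>2 * \<beta>\<^sup>2)) / (\<sigma>\<^sup>2 * \<beta>\<^sup>2)"

definition rt_minus :: "real \<Rightarrow> real \<Rightarrow> real \<Rightarrow> real \<Rightarrow> real \<Rightarrow> real \<Rightarrow> real" where
  "rt_minus \<mu> \<sigma> \<gamma> \<delta> M \<beta> =
     (- (\<beta> * \<mu> - \<delta> - M) - sqrt ((\<beta> * \<mu> - \<delta> - M)\<^sup>2 + 2 * \<gamma> * \<sigma>\<^sup>2 * \<beta>\<^sup>2)) / (\<sigma>\<^sup>2 * \<beta>\<^sup>2)"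

definition c_const :: "real \<Rightarrow> real \<Rightarrow> real \<Rightarrow> real \<Rightarrow> real" where
  "c_const \<mu> \<sigma> \<gamma> \<delta> = 2 * \<delta> * \<mu> / (\<mu>\<^sup>2 + 2 * \<gamma> * \<sigma>\<^sup>2)"

definition Gamma_exp :: "real \<Rightarrow> real \<Rightarrow> real \<Rightarrow> real" where
  "Gamma_exp \<mu> \<sigma> \<gamma> = \<mu>\<^sup>2 / (\<mu>\<^sup>2 + 2 * \<gamma> * \<sigma>\<^sup>2)"

definition M_thr :: "real \<Rightarrow> real \<Rightarrow> real \<Rightarrow> real \<Rightarrow> real \<Rightarrow> real" where
  "M_thr \<mu> \<sigma> \<gamma> \<delta> \<beta> =
     (\<beta> - c_const \<mu> \<sigma> \<gamma> \<delta>) * ((\<mu>\<^sup>2 + 2 * \<gamma> * \<sigma>\<^sup>2) / (2 * \<mu>))"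

(* G is only meaningful for u > c; G_inv inverts its restriction to that half-line. *)
definition G :: "real \<Rightarrow> real \<Rightarrow> real \<Rightarrow> real \<Rightarrow> real \<Rightarrow> real" where
  "G \<mu> \<sigma> \<gamma> \<delta> u = u + c_const \<mu> \<sigma> \<gamma> \<delta> * ln (u - c_const \<mu> \<sigma> \<gamma> \<delta>)"

definition G_inv :: "real \<Rightarrow> real \<Rightarrow> real \<Rightarrow> real \<Rightarrow> real \<Rightarrow> real" where
  "G_inv \<mu> \<sigma> \<gamma> \<delta> = the_inv_into {c_const \<mu> \<sigma> \<gamma> \<delta> <..} (G \<mu> \<sigma> \<gamma> \<delta>)"

definition x_beta :: "real \<Rightarrow> real \<Rightarrow> real \<Rightarrow> real \<Rightarrow> real \<Rightarrow> real" where
  "x_beta \<mu> \<sigma> \<gamma> \<delta> \<beta> =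
     \<mu> * \<sigma>\<^sup>2 / (\<mu>\<^sup>2 + 2 * \<gamma> * \<sigma>\<^sup>2) * (G \<mu> \<sigma> \<gamma> \<delta> \<beta> - G \<mu> \<sigma> \<gamma> \<delta> (2 * \<delta> / \<mu>))"

definition a_fun :: "real \<Rightarrow> real \<Rightarrow> real \<Rightarrow> real \<Rightarrow> real \<Rightarrow> real" where
  "a_fun \<mu> \<sigma> \<gamma> \<delta> x =
     G_inv \<mu> \<sigma> \<gamma> \<delta>
       ((\<mu>\<^sup>2 + 2 * \<gamma> * \<sigma>\<^sup>2) / (\<mu> * \<sigma>\<^sup>2) * x + G \<mu> \<sigma> \<gamma> \<delta> (2 * \<delta> / \<mu>))"

definition K1 :: "real \<Rightarrow> real \<Rightarrow> real \<Rightarrow> real \<Rightarrow> real \<Rightarrow> real \<Rightarrow> real" where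
  "K1 \<mu> \<sigma> \<gamma> \<delta> M \<beta> =
     (rt_minus \<mu> \<sigma> \<gamma> \<delta> M \<beta> - r_minus \<mu> \<sigma> \<gamma> \<delta> \<beta>) /
     (r_plus \<mu> \<sigma> \<gamma> \<delta> \<beta> * (r_plus \<mu> \<sigma> \<gamma> \<delta> \<beta> - r_minus \<mu> \<sigma> \<gamma> \<delta> \<beta>))"

definition K2 :: "real \<Rightarrow> real \<Rightarrow> real \<Rightarrow> real \<Rightarrow> real \<Rightarrow> real \<Rightarrow> real" where
  "K2 \<mu> \<sigma> \<gamma> \<delta> M \<beta> =
     (r_plus \<mu> \<sigma> \<gamma> \<delta> \<beta> - rt_minus \<mu> \<sigma> \<gamma> \<delta> M \<beta>) /
     (r_minus \<mu> \<sigma> \<gamma> \<delta> \<beta> * (r_plus \<mu> \<sigma> \<gamma> \<delta> \<beta> - r_minus \<mu> \<sigma> \<gamma> \<delta> \<beta>))"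

definition Delta :: "real \<Rightarrow> real \<Rightarrow> real \<Rightarrow> real \<Rightarrow> real \<Rightarrow> real \<Rightarrow> real" where
  "Delta \<mu> \<sigma> \<gamma> \<delta> M \<beta> =
     1 / (r_plus \<mu> \<sigma> \<gamma> \<delta> \<beta> - r_minus \<mu> \<sigma> \<gamma> \<delta> \<beta>) *
     ln (- (((r_plus \<mu> \<sigma> \<gamma> \<delta> \<beta> - rt_minus \<mu> \<sigma> \<gamma> \<delta> M \<beta>) * (\<mu> + \<beta> * \<sigma>\<^sup>2 * r_minus \<mu> \<sigma> \<gamma> \<delta> \<beta>)) /
            ((rt_minus \<mu> \<sigma> \<gamma> \<delta> M \<beta> - r_minus \<mu> \<sigma> \<gamma> \<delta> \<beta>) * (\<mu> + \<beta> * \<sigma>\<^sup>2 * r_plus \<mu> \<sigma> \<gamma> \<delta> \<beta>))))"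

definition x_one :: "real \<Rightarrow> real \<Rightarrow> real \<Rightarrow> real \<Rightarrow> real \<Rightarrow> real \<Rightarrow> real" where
  "x_one \<mu> \<sigma> \<gamma> \<delta> M \<beta> = x_beta \<mu> \<sigma> \<gamma> \<delta> \<beta> - Delta \<mu> \<sigma> \<gamma> \<delta> M \<beta>"

(* The constant written V'(0), given by its explicit formula. *)
definition V_prime0 :: "real \<Rightarrow> real \<Rightarrow> real \<Rightarrow> real \<Rightarrow> real \<Rightarrow> real \<Rightarrow> real" where
  "V_prime0 \<mu> \<sigma> \<gamma> \<delta> M \<beta> =
     2 * \<gamma> / (\<mu> * \<beta> - 2 * \<delta>) *
     ((\<beta> - c_const \<mu> \<sigma> \<gamma> \<delta>) / (2 * \<delta> / \<mu> - c_const \<mu> \<sigma> \<gamma> \<delta>)) powr (Gamma_exp \<mu> \<sigma> \<gamma>) *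
     (K1 \<mu> \<sigma> \<gamma> \<delta> M \<beta> * exp (r_plus \<mu> \<sigma> \<gamma> \<delta> \<beta> * Delta \<mu> \<sigma> \<gamma> \<delta> M \<beta>) +
      K2 \<mu> \<sigma> \<gamma> \<delta> M \<beta> * exp (r_minus \<mu> \<sigma> \<gamma> \<delta> \<beta> * Delta \<mu> \<sigma> \<gamma> \<delta> M \<beta>))"

(* V is a function on the half-line x \<ge> 0; values at negative x are irrelevant. *)
definition V_fun :: "real \<Rightarrow> real \<Rightarrow> real \<Rightarrow> real \<Rightarrow> real \<Rightarrow> real \<Rightarrow> real \<Rightarrow> real" where
  "V_fun \<mu> \<sigma> \<gamma> \<delta> M \<beta> x =
     (if x < x_beta \<mu> \<sigma> \<gamma> \<delta> \<beta> then
        V_prime0 \<mu> \<sigma> \<gamma> \<delta> M \<beta> * ((\<mu> * a_fun \<mu> \<sigma> \<gamma> \<delta> x - 2 * \<delta>) / (2 * \<gamma>)) *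
        ((a_fun \<mu> \<sigma> \<gamma> \<delta> x - c_const \<mu> \<sigma> \<gamma> \<delta>) / (2 * \<delta> / \<mu> - c_const \<mu> \<sigma> \<gamma> \<delta>))
          powr (- Gamma_exp \<mu> \<sigma> \<gamma>)
      else if x < x_one \<mu> \<sigma> \<gamma> \<delta> M \<beta> then
        K1 \<mu> \<sigma> \<gamma> \<delta> M \<beta> * exp (r_plus \<mu> \<sigma> \<gamma> \<delta> \<beta> * (x - x_one \<mu> \<sigma> \<gamma> \<delta> M \<beta>)) +
        K2 \<mu> \<sigma> \<gamma> \<delta> M \<beta> * exp (r_minus \<mu> \<sigma> \<gamma> \<delta> \<beta> * (x - x_one \<mu> \<sigma> \<gamma> \<delta> M \<beta>))
      else
        M / \<gamma> + 1 / rt_minus \<mu> \<sigma> \<gamma> \<delta> M \<beta> *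
          exp (rt_minus \<mu> \<sigma> \<gamma> \<delta> M \<beta> * (x - x_one \<mu> \<sigma> \<gamma> \<delta> M \<beta>)))"

(* f is C^2 on S with first and second derivatives f1 and f2; derivatives are
   taken within S, hence one-sided at a boundary point of an interval. *)
definition C2_on_with :: "(real \<Rightarrow> real) \<Rightarrow> (real \<Rightarrow> real) \<Rightarrow> (real \<Rightarrow> real) \<Rightarrow> real set \<Rightarrow> bool" where
  "C2_on_with f f1 f2 S \<longleftrightarrow>
     (\<forall>x\<in>S. (f has_real_derivative f1 x) (at x within S)) \<and>
     (\<forall>x\<in>S. (f1 has_real_derivative f2 x) (at x within S)) \<and>
     continuous_on S f2"

(* m is the (attained) maximum of f over S; Max is unsuitable for infinite S. *)
definition is_max_over :: "real \<Rightarrow> (real \<Rightarrow> real) \<Rightarrow> real set \<Rightarrow> bool" where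
  "is_max_over m f S \<longleftrightarrow> (\<exists>s\<in>S. f s = m) \<and> (\<forall>s\<in>S. f s \<le> m)"

(* HJB equation on the half-line x \<ge> 0 together with the boundary condition
   v(0) = 0; v1 and v2 play the roles of v' and v''. *)
definition HJB_solution ::
  "real \<Rightarrow> real \<Rightarrow> real \<Rightarrow> real \<Rightarrow> real \<Rightarrow> real \<Rightarrow> real \<Rightarrow>
   (real \<Rightarrow> real) \<Rightarrow> (real \<Rightarrow> real) \<Rightarrow> (real \<Rightarrow> real) \<Rightarrow> bool" where
  "HJB_solution \<mu> \<sigma> \<gamma> \<delta> M \<alpha> \<beta> v v1 v2 \<longleftrightarrow>
     (\<forall>x\<ge>0. is_max_over 0
        (\<lambda>a. 1 / 2 * \<sigma>\<^sup>2 * a\<^sup>2 * v2 x + (a * \<mu> - \<delta>) * v1 x - \<gamma> * v x + M * max (1 - v1 x) 0)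
        {\<alpha>..\<beta>}) \<and>
     v 0 = 0"

end

theory Submission
  imports Defs
begin

text \<open>
  For a trial function with \<open>V' > 0 > V''\<close>, the expression in the HJB equation is, apart from the
  dividend term \<open>M (1 - V')\<^sup>+\<close>, a concave quadratic in the control with vertex
  \<open>- \<mu> V' / (\<sigma>\<^sup>2 V'')\<close>. It vanishes at its maximum on each of three regions for a different reason.

  \<^item> Below \<open>x\<^sub>\<beta>\<close> the vertex is \<open>a(x)\<close>, which lies in \<open>[2\<delta>/\<mu>, \<beta>]\<close>. The function \<open>a\<close> solves
    \<open>a' = D (a - c) / (\<mu> \<sigma>\<^sup>2 a)\<close> with \<open>D = \<mu>\<^sup>2 + 2 \<gamma> \<sigma>\<^sup>2\<close>, because \<open>G' u = u / (u - c)\<close>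
    (lemma \<open>a_deriv\<close>). Differentiating the explicit formula with this ODE gives
    \<open>V' = V'(0) w\<^sup>-\<^sup>\<Gamma>\<close> with \<open>w = (a - c) / (2\<delta>/\<mu> - c)\<close>, and \<open>V'' = - \<mu> V' / (\<sigma>\<^sup>2 a)\<close>.
  \<^item> Between \<open>x\<^sub>\<beta>\<close> and \<open>x\<^sub>1\<close> the vertex has passed \<open>\<beta>\<close>, so \<open>\<beta>\<close> is optimal and the equation
    is linear with constant coefficients and characteristic roots \<open>r\<^sub>\<plusminus>\<close>.
  \<^item> Beyond \<open>x\<^sub>1\<close> also \<open>V' \<le> 1\<close>, dividends are paid at the full rate \<open>M\<close>, and the decaying root
    of the equation with drift reduced by \<open>M\<close> remains.

  The constants make the pieces fit to second order: \<open>K\<^sub>1, K\<^sub>2\<close> impose \<open>V' = 1\<close> and \<open>V'' = r\<close> at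
  \<open>x\<^sub>1\<close>, where \<open>r\<close> is that decaying root; \<open>\<Delta>\<close> is the zero of \<open>\<mu> V' + \<beta> \<sigma>\<^sup>2 V''\<close>,
  measured from \<open>x\<^sub>1\<close>, which says that the vertex equals \<open>\<beta>\<close> at \<open>x\<^sub>\<beta>\<close>; and \<open>V'(0)\<close> matches
  the values at \<open>x\<^sub>\<beta>\<close>. One remaining derivative at each junction then agrees because the same
  equation holds on both sides (lemmas \<open>fit_x1\<close> and \<open>fit_xb\<close>).

  What makes the construction consistent is the position of the critical slope
  \<open>- \<mu> / (\<beta> \<sigma>\<^sup>2)\<close> among the roots. It always lies strictly between \<open>r\<^sub>-\<close> and \<open>r\<^sub>+\<close>, so
  \<open>\<Delta>\<close> is well defined, and it is at most the decaying root exactly when \<open>M \<ge> M\<^sub>\<beta>\<close>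
  (lemma \<open>quadratic_at_critical_slope\<close>). The latter gives both \<open>\<Delta> \<le> 0\<close>, that is
  \<open>x\<^sub>\<beta> \<le> x\<^sub>1\<close>, and the optimality of \<open>\<beta>\<close> beyond \<open>x\<^sub>1\<close>.

  Concavity is the sign of \<open>V''\<close> on each piece. Together with \<open>V'(x\<^sub>1) = 1\<close> it shows that \<open>V' \<ge> 1\<close>
  before \<open>x\<^sub>1\<close> and \<open>V' \<le> 1\<close> after it, which decides the dividend term. Since \<open>V' > 0\<close>, \<open>V\<close>
  increases from \<open>V(0) = 0\<close> towards \<open>M/\<gamma>\<close>.
\<close>

section \<open>Gluing functions at a point\<close>

definition glue :: "real \<Rightarrow> (real \<Rightarrow> real) \<Rightarrow> (real \<Rightarrow> real) \<Rightarrow> real \<Rightarrow> real" where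
  "glue p f g = (\<lambda>x. if x < p then f x else g x)"

lemma glue_altdef:
  assumes "f p = g p"
  shows "glue p f g = (\<lambda>x. if x \<le> p then f x else g x)"
  using assms by (auto simp: glue_def fun_eq_iff)

lemma continuous_on_glue:
  assumes "continuous_on UNIV f" "continuous_on UNIV g" "f p = g p"
  shows "continuous_on UNIV (glue p f g)"
  unfolding glue_altdef[of f p g, OF assms(3)]
  by (rule continuous_on_cases_1) (use assms in \<open>auto intro: continuous_on_subset\<close>)

text \<open>
  All pieces of the value function are smooth on the whole line, not merely on their own interval,
  so the derivatives of the pieces may be required everywhere.
\<close>

lemma has_real_derivative_glue:
  assumes f: "\<And>x. (f has_real_derivative f' x) (at x)"
    and g: "\<And>x. (g has_real_derivative g' x) (at x)"
    and "f p = g p" "f' p = g' p"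
  shows "(glue p f g has_real_derivative glue p f' g' x) (at x)"
proof (cases x p rule: linorder_cases)
  case less
  have "(glue p f g has_real_derivative f' x) (at x)"
    by (rule has_field_derivative_transform_within_open[OF f, where S = "{..<p}"])
       (use less in \<open>auto simp: glue_def\<close>)
  then show ?thesis using less by (simp add: glue_def)
next
  case greater
  have "(glue p f g has_real_derivative g' x) (at x)"
    by (rule has_field_derivative_transform_within_open[OF g, where S = "{p<..}"])
       (use greater in \<open>auto simp: glue_def\<close>)
  then show ?thesis using greater by (simp add: glue_def)
next
  case equal
  \<comment> \<open>At the junction the two one-sided derivatives exist and coincide.\<close>
  have "(glue p f g has_real_derivative g' p) (at p within {..p} \<union> {p..})"
  proof -
    have "(glue p f g has_real_derivative g' p) (at p within {..p})"
      by (rule has_field_derivative_transform_within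
            [OF has_field_derivative_at_within[OF f[of p], unfolded assms(4)], of 1])
         (auto simp: glue_def assms(3))
    moreover have "(glue p f g has_real_derivative g' p) (at p within {p..})"
      by (rule has_field_derivative_transform_within
            [OF has_field_derivative_at_within[OF g], of 1])
         (auto simp: glue_def)
    ultimately show ?thesis
      by (simp add: has_field_derivative_iff Lim_Un)
  qed
  moreover have "{..p} \<union> {p..} = (UNIV :: real set)" by auto
  ultimately show ?thesis using equal by (simp add: glue_def)
qed

section \<open>The characteristic quadratic\<close>

lemma r_roots_factor:
  assumes "\<sigma> \<noteq> 0" "\<beta> \<noteq> 0" "\<gamma> > 0"
  shows "1/2 * \<sigma>\<^sup>2 * \<beta>\<^sup>2 * r\<^sup>2 + (\<beta> * \<mu> - \<delta>) * r - \<gamma>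
    = 1/2 * \<sigma>\<^sup>2 * \<beta>\<^sup>2 * ((r - r_plus \<mu> \<sigma> \<gamma> \<delta> \<beta>) * (r - r_minus \<mu> \<sigma> \<gamma> \<delta> \<beta>))"
proof -
  define q b s where "q = \<sigma>\<^sup>2 * \<beta>\<^sup>2" and "b = \<beta> * \<mu> - \<delta>" and "s = sqrt (b\<^sup>2 + 2 * \<gamma> * q)"
  have q: "q > 0" using assms by (simp add: q_def)
  have s: "s * s = b * b + 2 * \<gamma> * q" using q assms by (simp add: s_def power2_eq_square)
  have *: "r_plus \<mu> \<sigma> \<gamma> \<delta> \<beta> = (- b + s) / q" "r_minus \<mu> \<sigma> \<gamma> \<delta> \<beta> = (- b - s) / q"
    by (simp_all add: r_plus_def r_minus_def q_def b_def s_def algebra_simps)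
  have "q * ((r - (- b + s) / q) * (r - (- b - s) / q)) = ((q * r + b) * (q * r + b) - s * s) / q"
    using q by (simp add: field_simps)
  also have "\<dots> = q * r\<^sup>2 + 2 * b * r - 2 * \<gamma>"
    unfolding s using q by (simp add: field_simps power2_eq_square)
  finally have "q * ((r - (- b + s) / q) * (r - (- b - s) / q)) = q * r\<^sup>2 + 2 * b * r - 2 * \<gamma>" .
  then have "1/2 * q * r\<^sup>2 + b * r - \<gamma> = 1/2 * q * ((r - (- b + s) / q) * (r - (- b - s) / q))"
    by (simp only: mult.assoc) (simp add: algebra_simps)
  then show ?thesis unfolding * q_def b_def by (simp only: mult.assoc)
qed

lemma r_roots_sign:
  assumes "\<sigma> \<noteq> 0" "\<beta> \<noteq> 0" "\<gamma> > 0"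
  shows "r_minus \<mu> \<sigma> \<gamma> \<delta> \<beta> < 0" "0 < r_plus \<mu> \<sigma> \<gamma> \<delta> \<beta>"
proof -
  have "sqrt ((\<beta> * \<mu> - \<delta>)\<^sup>2) < sqrt ((\<beta> * \<mu> - \<delta>)\<^sup>2 + 2 * \<gamma> * \<sigma>\<^sup>2 * \<beta>\<^sup>2)"
    using assms by (intro real_sqrt_less_mono) simp
  then have *: "\<bar>\<beta> * \<mu> - \<delta>\<bar> < sqrt ((\<beta> * \<mu> - \<delta>)\<^sup>2 + 2 * \<gamma> * \<sigma>\<^sup>2 * \<beta>\<^sup>2)"
    by simp
  have "\<sigma>\<^sup>2 * \<beta>\<^sup>2 > 0" using assms by simp
  then show "r_minus \<mu> \<sigma> \<gamma> \<delta> \<beta> < 0" "0 < r_plus \<mu> \<sigma> \<gamma> \<delta> \<beta>"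
    using * unfolding r_minus_def r_plus_def
    by (auto intro!: divide_neg_pos divide_pos_pos)
qed

lemma between_r_roots:
  assumes "\<sigma> \<noteq> 0" "\<beta> \<noteq> 0" "\<gamma> > 0"
    and "1/2 * \<sigma>\<^sup>2 * \<beta>\<^sup>2 * r\<^sup>2 + (\<beta> * \<mu> - \<delta>) * r - \<gamma> < 0"
  shows "r_minus \<mu> \<sigma> \<gamma> \<delta> \<beta> < r" "r < r_plus \<mu> \<sigma> \<gamma> \<delta> \<beta>"
proof -
  have q: "1/2 * \<sigma>\<^sup>2 * \<beta>\<^sup>2 > 0" using assms by simp
  have "(r - r_plus \<mu> \<sigma> \<gamma> \<delta> \<beta>) * (r - r_minus \<mu> \<sigma> \<gamma> \<delta> \<beta>) < 0"
    using assms(4) q unfolding r_roots_factor[OF assms(1-3)]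
    by (metis mult_less_0_iff order_less_asym)
  moreover have "r_minus \<mu> \<sigma> \<gamma> \<delta> \<beta> < r_plus \<mu> \<sigma> \<gamma> \<delta> \<beta>"
    using r_roots_sign[OF assms(1-3), of \<mu> \<delta>] by linarith
  ultimately show "r_minus \<mu> \<sigma> \<gamma> \<delta> \<beta> < r" "r < r_plus \<mu> \<sigma> \<gamma> \<delta> \<beta>"
    by (auto simp: mult_less_0_iff)
qed

lemma le_r_minus:
  assumes "\<sigma> \<noteq> 0" "\<beta> \<noteq> 0" "\<gamma> > 0" "r < 0"
    and "1/2 * \<sigma>\<^sup>2 * \<beta>\<^sup>2 * r\<^sup>2 + (\<beta> * \<mu> - \<delta>) * r - \<gamma> \<ge> 0"
  shows "r \<le> r_minus \<mu> \<sigma> \<gamma> \<delta> \<beta>"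
proof -
  have q: "1/2 * \<sigma>\<^sup>2 * \<beta>\<^sup>2 > 0" using assms by simp
  have "(r - r_plus \<mu> \<sigma> \<gamma> \<delta> \<beta>) * (r - r_minus \<mu> \<sigma> \<gamma> \<delta> \<beta>) \<ge> 0"
    using assms(5) q unfolding r_roots_factor[OF assms(1-3)]
    by (metis zero_le_mult_iff not_le)
  moreover have "r - r_plus \<mu> \<sigma> \<gamma> \<delta> \<beta> < 0"
    using r_roots_sign[OF assms(1-3), of \<mu> \<delta>] assms(4) by linarith
  ultimately show ?thesis by (simp add: zero_le_mult_iff)
qed

text \<open>
  Paying dividends at rate \<open>M\<close> acts on the drift like additional debt payments, so every fact on
  \<open>r_minus\<close> also serves for \<open>rt_minus\<close>.
\<close>

lemma rt_minus_eq_r_minus: "rt_minus \<mu> \<sigma> \<gamma> \<delta> M \<beta> = r_minus \<mu> \<sigma> \<gamma> (\<delta> + M) \<beta>"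
  by (simp add: rt_minus_def r_minus_def algebra_simps)

section \<open>The pointwise maximisation over the control\<close>

text \<open>
  Expanding the quadratic around \<open>s\<close> leaves a linear term, governed by \<open>opt\<close>, and a
  nonpositive square. The condition \<open>opt\<close> covers both an interior vertex, where the slope
  vanishes, and a maximum at the right end point, where the slope is nonnegative. The dividend term
  does not depend on the control and belongs to \<open>C\<close>.
\<close>

lemma hjb_max_at:
  assumes "s \<in> {\<alpha>..\<beta>}" "B \<le> 0"
    and opt: "\<And>a. a \<in> {\<alpha>..\<beta>} \<Longrightarrow> (a - s) * (\<mu> * A + s * \<sigma>\<^sup>2 * B) \<le> 0"
    and zero: "1 / 2 * \<sigma>\<^sup>2 * s\<^sup>2 * B + (s * \<mu> - \<delta>) * A + C = 0"
  shows "is_max_over 0 (\<lambda>a. 1 / 2 * \<sigma>\<^sup>2 * a\<^sup>2 * B + (a * \<mu> - \<delta>) * A + C) {\<alpha>..\<beta>}"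
  unfolding is_max_over_def
proof (intro conjI bexI ballI)
  fix a assume a: "a \<in> {\<alpha>..\<beta>}"
  have "1 / 2 * \<sigma>\<^sup>2 * a\<^sup>2 * B + (a * \<mu> - \<delta>) * A + C
     = (a - s) * (\<mu> * A + s * \<sigma>\<^sup>2 * B) + 1 / 2 * \<sigma>\<^sup>2 * (a - s)\<^sup>2 * B"
    using zero by (simp add: power2_eq_square field_simps)
  moreover have "1 / 2 * \<sigma>\<^sup>2 * (a - s)\<^sup>2 * B \<le> 0"
    using \<open>B \<le> 0\<close> by (intro mult_nonneg_nonpos) auto
  ultimately show "1 / 2 * \<sigma>\<^sup>2 * a\<^sup>2 * B + (a * \<mu> - \<delta>) * A + C \<le> 0"
    using opt[OF a] by linarith
qed (use assms in auto)

section \<open>The value function and its pieces\<close>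

text \<open>
  Strict positivity of \<open>\<delta>\<close> follows from \<open>0 < \<alpha> \<le> 2 \<delta> / \<mu>\<close>. It makes \<open>c\<close> positive, so
  that the logarithm drives \<open>G\<close> to \<open>- \<infinity>\<close> at \<open>c\<close> and \<open>G\<close> maps \<open>{c<..}\<close> onto the reals.
\<close>

locale dividend_model =
  fixes \<mu> \<sigma> \<gamma> \<delta> M \<beta> :: real
  assumes mu: "\<mu> > 0" and sigma: "\<sigma> > 0" and gamma: "\<gamma> > 0" and delta: "\<delta> > 0"
    and M: "M > 0" and beta: "2 * \<delta> / \<mu> < \<beta>" and M_thr: "M_thr \<mu> \<sigma> \<gamma> \<delta> \<beta> \<le> M"
begin

abbreviation "c \<equiv> c_const \<mu> \<sigma> \<gamma> \<delta>"
abbreviation "\<Gamma> \<equiv> Gamma_exp \<mu> \<sigma> \<gamma>"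
abbreviation "rp \<equiv> r_plus \<mu> \<sigma> \<gamma> \<delta> \<beta>"
abbreviation "rm \<equiv> r_minus \<mu> \<sigma> \<gamma> \<delta> \<beta>"
abbreviation "rt \<equiv> rt_minus \<mu> \<sigma> \<gamma> \<delta> M \<beta>"
abbreviation "a \<equiv> a_fun \<mu> \<sigma> \<gamma> \<delta>"
abbreviation "\<Delta> \<equiv> Delta \<mu> \<sigma> \<gamma> \<delta> M \<beta>"
abbreviation "x\<^sub>\<beta> \<equiv> x_beta \<mu> \<sigma> \<gamma> \<delta> \<beta>"
abbreviation "x\<^sub>1 \<equiv> x_one \<mu> \<sigma> \<gamma> \<delta> M \<beta>"
abbreviation "k\<^sub>1 \<equiv> K1 \<mu> \<sigma> \<gamma> \<delta> M \<beta>"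
abbreviation "k\<^sub>2 \<equiv> K2 \<mu> \<sigma> \<gamma> \<delta> M \<beta>"
abbreviation "D \<equiv> \<mu>\<^sup>2 + 2 * \<gamma> * \<sigma>\<^sup>2"
abbreviation "V\<^sub>0 \<equiv> V_prime0 \<mu> \<sigma> \<gamma> \<delta> M \<beta>"

lemma beta_pos: "\<beta> > 0"
  using beta mu delta by (smt (verit) divide_pos_pos)

lemma D_pos: "D > 0"
  using mu gamma sigma by (simp add: add_pos_pos)

lemma c_pos: "c > 0"
  using mu delta D_pos by (simp add: c_const_def)

lemma c_less: "c < 2 * \<delta> / \<mu>"
proof -
  have "2 * \<delta> * \<mu> * \<mu> < 2 * \<delta> * D"
    using delta gamma sigma by (simp add: power2_eq_square algebra_simps)
  then show ?thesis using D_pos mu by (simp add: c_const_def field_simps)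
qed

lemma c_less_beta: "c < \<beta>"
  using c_less beta by linarith

subsection \<open>Position of the roots\<close>

lemma r_signs: "rm < 0" "0 < rp" "rt < 0"
  using r_roots_sign sigma gamma beta_pos by (simp_all add: rt_minus_eq_r_minus)

lemma rp_root: "1/2 * \<sigma>\<^sup>2 * \<beta>\<^sup>2 * rp\<^sup>2 + (\<beta> * \<mu> - \<delta>) * rp - \<gamma> = 0"
  and rm_root: "1/2 * \<sigma>\<^sup>2 * \<beta>\<^sup>2 * rm\<^sup>2 + (\<beta> * \<mu> - \<delta>) * rm - \<gamma> = 0"
  and rt_root: "1/2 * \<sigma>\<^sup>2 * \<beta>\<^sup>2 * rt\<^sup>2 + (\<beta> * \<mu> - (\<delta> + M)) * rt - \<gamma> = 0"
  using sigma gamma beta_pos unfolding rt_minus_eq_r_minus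
  by (subst r_roots_factor; simp)+

text \<open>
  The two characteristic quadratics differ by \<open>M r\<close>, so at the negative root of the second one the
  first one is negative.
\<close>

lemma rt_between: "rm < rt" "rt < rp"
proof -
  have "1/2 * \<sigma>\<^sup>2 * \<beta>\<^sup>2 * rt\<^sup>2 + (\<beta> * \<mu> - \<delta>) * rt - \<gamma> = M * rt"
    using rt_root by (simp add: algebra_simps)
  also have "\<dots> < 0" using M r_signs by (simp add: mult_pos_neg)
  finally show "rm < rt" "rt < rp"
    using between_r_roots sigma gamma beta_pos by simp_all
qed

text \<open>
  At \<open>r = - \<mu> / (\<beta> \<sigma>\<^sup>2)\<close> the solution \<open>e\<^sup>r\<^sup>x\<close> has the vertex of the control quadratic exactly at
  \<open>\<beta>\<close>. With \<open>d = \<delta>\<close> the value below is negative; with \<open>d = \<delta> + M\<close> its sign is that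
  of \<open>M - M\<^sub>\<beta>\<close>, which is where the threshold comes from.
\<close>

lemma quadratic_at_critical_slope:
  "1/2 * \<sigma>\<^sup>2 * \<beta>\<^sup>2 * (- \<mu> / (\<beta> * \<sigma>\<^sup>2))\<^sup>2 + (\<beta> * \<mu> - d) * (- \<mu> / (\<beta> * \<sigma>\<^sup>2)) - \<gamma>
    = \<mu> / (\<beta> * \<sigma>\<^sup>2) * (d - \<delta> - M_thr \<mu> \<sigma> \<gamma> \<delta> \<beta>)"
proof -
  have "c * D = 2 * \<delta> * \<mu>" using D_pos by (simp add: c_const_def)
  then have "M_thr \<mu> \<sigma> \<gamma> \<delta> \<beta> = (\<beta> * D - 2 * \<delta> * \<mu>) / (2 * \<mu>)"
    by (simp add: M_thr_def left_diff_distrib)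
  then have thr: "M_thr \<mu> \<sigma> \<gamma> \<delta> \<beta> = \<beta> * D / (2 * \<mu>) - \<delta>"
    using mu by (simp add: diff_divide_distrib)
  show ?thesis
    unfolding thr using mu sigma beta_pos by (simp add: field_simps power2_eq_square)
qed

lemma M_thr_pos: "M_thr \<mu> \<sigma> \<gamma> \<delta> \<beta> > 0"
  using c_less_beta D_pos mu by (simp add: M_thr_def)

lemma slope_rm: "\<mu> + \<beta> * \<sigma>\<^sup>2 * rm < 0" and slope_rp: "\<mu> + \<beta> * \<sigma>\<^sup>2 * rp > 0"
proof -
  have "\<mu> / (\<beta> * \<sigma>\<^sup>2) * (\<delta> - \<delta> - M_thr \<mu> \<sigma> \<gamma> \<delta> \<beta>) < 0"
    using M_thr_pos mu sigma beta_pos by (intro mult_pos_neg) auto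
  then have "1/2 * \<sigma>\<^sup>2 * \<beta>\<^sup>2 * (- \<mu> / (\<beta> * \<sigma>\<^sup>2))\<^sup>2 + (\<beta> * \<mu> - \<delta>) * (- \<mu> / (\<beta> * \<sigma>\<^sup>2)) - \<gamma> < 0"
    unfolding quadratic_at_critical_slope .
  then have "rm < - \<mu> / (\<beta> * \<sigma>\<^sup>2)" "- \<mu> / (\<beta> * \<sigma>\<^sup>2) < rp"
    using between_r_roots sigma gamma beta_pos by (metis less_irrefl)+
  then show "\<mu> + \<beta> * \<sigma>\<^sup>2 * rm < 0" "\<mu> + \<beta> * \<sigma>\<^sup>2 * rp > 0"
    using sigma beta_pos by (simp_all add: field_simps)
qed

lemma slope_rt: "\<mu> + \<beta> * \<sigma>\<^sup>2 * rt \<ge> 0"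
proof -
  have "\<mu> / (\<beta> * \<sigma>\<^sup>2) * ((\<delta> + M) - \<delta> - M_thr \<mu> \<sigma> \<gamma> \<delta> \<beta>) \<ge> 0"
    using M_thr mu sigma beta_pos by (intro mult_nonneg_nonneg) auto
  then have "1/2 * \<sigma>\<^sup>2 * \<beta>\<^sup>2 * (- \<mu> / (\<beta> * \<sigma>\<^sup>2))\<^sup>2
      + (\<beta> * \<mu> - (\<delta> + M)) * (- \<mu> / (\<beta> * \<sigma>\<^sup>2)) - \<gamma> \<ge> 0"
    unfolding quadratic_at_critical_slope .
  then have "- \<mu> / (\<beta> * \<sigma>\<^sup>2) \<le> rt"
    unfolding rt_minus_eq_r_minus using sigma gamma beta_pos mu by (intro le_r_minus) auto
  then show ?thesis
    using sigma beta_pos by (simp add: field_simps)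
qed

lemma k1_rp: "k\<^sub>1 * rp = (rt - rm) / (rp - rm)"
  and k2_rm: "k\<^sub>2 * rm = (rp - rt) / (rp - rm)"
  using r_signs by (simp_all add: K1_def K2_def)

text \<open>
  Both factors \<open>\<mu> + \<beta> \<sigma>\<^sup>2 r\<^sub>\<plusminus>\<close> have known, opposite signs, so the argument of the logarithm in
  \<open>\<Delta>\<close> is positive and the logarithm can be undone.
\<close>

lemma exp_Delta:
  "(rt - rm) * (\<mu> + \<beta> * \<sigma>\<^sup>2 * rp) * exp ((rp - rm) * \<Delta>)
    = - ((rp - rt) * (\<mu> + \<beta> * \<sigma>\<^sup>2 * rm))"
proof -
  define N where "N = (rp - rt) * (\<mu> + \<beta> * \<sigma>\<^sup>2 * rm)"
  define P where "P = (rt - rm) * (\<mu> + \<beta> * \<sigma>\<^sup>2 * rp)"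
  have N: "N < 0" and P: "P > 0"
    using rt_between slope_rm slope_rp by (auto simp: N_def P_def mult_pos_neg)
  have "(rp - rm) * \<Delta> = ln (- (N / P))"
    using r_signs unfolding Delta_def N_def P_def by simp
  then have "exp ((rp - rm) * \<Delta>) = - (N / P)"
    using N P by (simp add: divide_neg_pos)
  then show ?thesis unfolding N_def[symmetric] P_def[symmetric] using P by simp
qed

text \<open>
  The inequality \<open>exp ((rp - rm) \<Delta>) \<le> 1\<close> between numerator and denominator rearranges to
  \<open>\<mu> + \<beta> \<sigma>\<^sup>2 rt \<ge> 0\<close>.
\<close>

lemma Delta_nonpos: "\<Delta> \<le> 0"
proof -
  have "0 \<le> (rp - rm) * (\<mu> + \<beta> * \<sigma>\<^sup>2 * rt)"
    using slope_rt r_signs by (intro mult_nonneg_nonneg) auto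
  then have "- ((rp - rt) * (\<mu> + \<beta> * \<sigma>\<^sup>2 * rm)) \<le> (rt - rm) * (\<mu> + \<beta> * \<sigma>\<^sup>2 * rp)"
    by (simp add: algebra_simps)
  then have "(rt - rm) * (\<mu> + \<beta> * \<sigma>\<^sup>2 * rp) * exp ((rp - rm) * \<Delta>)
      \<le> (rt - rm) * (\<mu> + \<beta> * \<sigma>\<^sup>2 * rp) * 1"
    unfolding exp_Delta by simp
  moreover have "(rt - rm) * (\<mu> + \<beta> * \<sigma>\<^sup>2 * rp) > 0"
    using rt_between slope_rp by simp
  ultimately have "exp ((rp - rm) * \<Delta>) \<le> 1"
    by (simp only: mult_le_cancel_left_pos)
  then show ?thesis using r_signs by (simp add: mult_le_0_iff)
qed

lemma xb_le_x1: "x\<^sub>\<beta> \<le> x\<^sub>1"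
  using Delta_nonpos by (simp add: x_one_def)

subsection \<open>The optimal control below the threshold\<close>

lemma G_deriv:
  assumes "c < u"
  shows "(G \<mu> \<sigma> \<gamma> \<delta> has_real_derivative u / (u - c)) (at u)"
  unfolding G_def[abs_def] using assms
  by (auto intro!: derivative_eq_intros simp: field_simps)

lemma G_continuous: "continuous_on {c<..} (G \<mu> \<sigma> \<gamma> \<delta>)"
  by (intro continuous_at_imp_continuous_on ballI DERIV_isCont[OF G_deriv]) simp

lemma G_strict_mono: "strict_mono_on {c<..} (G \<mu> \<sigma> \<gamma> \<delta>)"
  unfolding G_def[abs_def]
  by (rule strict_mono_onI) (use c_pos in \<open>auto intro!: add_strict_mono mult_strict_left_mono\<close>)

lemma G_inj: "inj_on (G \<mu> \<sigma> \<gamma> \<delta>) {c<..}"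
  using G_strict_mono by (rule strict_mono_on_imp_inj_on)

text \<open>
  The intermediate value theorem applies between a point near \<open>c\<close>, where the logarithm brings \<open>G\<close>
  below \<open>y\<close>, and a large point, where the linear term lifts it above \<open>y\<close>.
\<close>

lemma G_surj: "\<exists>u>c. G \<mu> \<sigma> \<gamma> \<delta> u = y"
proof -
  \<comment> \<open>Since \<open>t \<le> 1\<close>, \<open>G (c + t) \<le> c + 1 + c ln t\<close>, and the exponential makes this at most \<open>y\<close>.\<close>
  define t where "t = min 1 (exp ((y - c - 1) / c))"
  have t: "t > 0" "t \<le> 1" by (auto simp: t_def)
  have "ln t \<le> (y - c - 1) / c"
    using t ln_le_cancel_iff[of t "exp ((y - c - 1) / c)"] by (auto simp: t_def)
  then have "c * ln t \<le> y - c - 1" using c_pos by (simp add: field_simps)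
  then have lo: "G \<mu> \<sigma> \<gamma> \<delta> (c + t) \<le> y" using t by (simp add: G_def)
  have "0 \<le> c * ln (max 1 y)" using c_pos by simp
  then have hi: "y \<le> G \<mu> \<sigma> \<gamma> \<delta> (c + max 1 y)"
    unfolding G_def using c_pos by (smt (verit) add_diff_cancel_left' max.cobounded2)
  have "continuous_on {c + t..c + max 1 y} (G \<mu> \<sigma> \<gamma> \<delta>)"
    by (rule continuous_on_subset[OF G_continuous]) (use t in auto)
  then obtain u where "c + t \<le> u" "G \<mu> \<sigma> \<gamma> \<delta> u = y"
    using IVT'[of "G \<mu> \<sigma> \<gamma> \<delta>" "c + t" y "c + max 1 y"] lo hi t by fastforce
  then show ?thesis using t by (intro exI[of _ u]) auto
qed

lemma G_a: "G \<mu> \<sigma> \<gamma> \<delta> (a x) = D / (\<mu> * \<sigma>\<^sup>2) * x + G \<mu> \<sigma> \<gamma> \<delta> (2 * \<delta> / \<mu>)"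
  and a_gt_c: "c < a x"
proof -
  define y where "y = D / (\<mu> * \<sigma>\<^sup>2) * x + G \<mu> \<sigma> \<gamma> \<delta> (2 * \<delta> / \<mu>)"
  have y: "y \<in> G \<mu> \<sigma> \<gamma> \<delta> ` {c<..}" using G_surj[of y] by auto
  show "G \<mu> \<sigma> \<gamma> \<delta> (a x) = y"
    using f_the_inv_into_f[OF G_inj y] by (simp add: a_fun_def G_inv_def y_def)
  show "c < a x"
    using the_inv_into_into[OF G_inj y order_refl] by (simp add: a_fun_def G_inv_def y_def)
qed

lemma a_eqI:
  assumes "c < u" "G \<mu> \<sigma> \<gamma> \<delta> u = D / (\<mu> * \<sigma>\<^sup>2) * x + G \<mu> \<sigma> \<gamma> \<delta> (2 * \<delta> / \<mu>)"
  shows "a x = u"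
  using inj_onD[OF G_inj, of "a x" u] G_a[of x] a_gt_c[of x] assms by simp

lemma a_0: "a 0 = 2 * \<delta> / \<mu>"
  by (rule a_eqI) (use c_less in auto)

lemma a_xb: "a x\<^sub>\<beta> = \<beta>"
  by (rule a_eqI) (use c_less_beta D_pos mu sigma in \<open>auto simp: x_beta_def\<close>)

lemma a_mono:
  assumes "x \<le> y"
  shows "a x \<le> a y"
proof -
  have "G \<mu> \<sigma> \<gamma> \<delta> (a x) \<le> G \<mu> \<sigma> \<gamma> \<delta> (a y)"
    unfolding G_a using assms D_pos mu sigma by (intro add_right_mono mult_left_mono) auto
  then show ?thesis
    using strict_mono_onD[OF G_strict_mono, of "a y" "a x"] a_gt_c[of x] a_gt_c[of y]
    by (force simp: not_le[symmetric])
qed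

lemma xb_pos: "x\<^sub>\<beta> > 0"
  using strict_mono_onD[OF G_strict_mono, of "2 * \<delta> / \<mu>" \<beta>] c_less c_less_beta beta D_pos mu sigma
  by (simp add: x_beta_def)

lemma a_deriv: "(a has_real_derivative D / (\<mu> * \<sigma>\<^sup>2) * (a x - c) / a x) (at x)"
proof -
  have ax: "c < a x" "0 < a x" using a_gt_c[of x] c_pos by auto
  define y where "y = D / (\<mu> * \<sigma>\<^sup>2) * x + G \<mu> \<sigma> \<gamma> \<delta> (2 * \<delta> / \<mu>)"
  have ay: "a x = G_inv \<mu> \<sigma> \<gamma> \<delta> y" by (simp add: a_fun_def y_def)
  have "(G_inv \<mu> \<sigma> \<gamma> \<delta> has_real_derivative inverse (a x / (a x - c))) (at y)"
    unfolding has_field_derivative_def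
  proof (rule has_derivative_inverse_strong_x[where S = "{c<..}"])
    show "(G \<mu> \<sigma> \<gamma> \<delta> has_derivative (*) (a x / (a x - c))) (at (G_inv \<mu> \<sigma> \<gamma> \<delta> y))"
      using G_deriv[OF ax(1)] by (simp add: ay has_field_derivative_def)
    show "G \<mu> \<sigma> \<gamma> \<delta> (G_inv \<mu> \<sigma> \<gamma> \<delta> y) = y" using G_a[of x] unfolding ay y_def .
    show "G_inv \<mu> \<sigma> \<gamma> \<delta> y \<in> {c<..}" using ax by (simp add: ay)
    show "G_inv \<mu> \<sigma> \<gamma> \<delta> (G \<mu> \<sigma> \<gamma> \<delta> u) = u" if "u \<in> {c<..}" for u
      using the_inv_into_f_f[OF G_inj that] by (simp add: G_inv_def)
  qed (use ax G_continuous in auto)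
  then have "((\<lambda>x. G_inv \<mu> \<sigma> \<gamma> \<delta> (D / (\<mu> * \<sigma>\<^sup>2) * x + G \<mu> \<sigma> \<gamma> \<delta> (2 * \<delta> / \<mu>)))
      has_real_derivative inverse (a x / (a x - c)) * (D / (\<mu> * \<sigma>\<^sup>2))) (at x)"
    unfolding y_def using mu sigma by (intro DERIV_chain2) (auto intro!: derivative_eq_intros)
  then show ?thesis
    unfolding a_fun_def[symmetric] by (simp add: mult_ac divide_simps)
qed

subsection \<open>The three pieces\<close>

definition left :: "real \<Rightarrow> real" where
  "left x = V\<^sub>0 * ((\<mu> * a x - 2 * \<delta>) / (2 * \<gamma>)) * ((a x - c) / (2 * \<delta> / \<mu> - c)) powr (- \<Gamma>)"

definition left' :: "real \<Rightarrow> real" where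
  "left' x = V\<^sub>0 * ((a x - c) / (2 * \<delta> / \<mu> - c)) powr (- \<Gamma>)"

definition left'' :: "real \<Rightarrow> real" where
  "left'' x = - \<mu> / \<sigma>\<^sup>2 * left' x / a x"

text \<open>The index counts derivatives; \<open>mid 0\<close> is the middle piece itself.\<close>

definition mid :: "nat \<Rightarrow> real \<Rightarrow> real" where
  "mid n x = k\<^sub>1 * rp ^ n * exp (rp * (x - x\<^sub>1)) + k\<^sub>2 * rm ^ n * exp (rm * (x - x\<^sub>1))"

definition right :: "real \<Rightarrow> real" where
  "right x = M / \<gamma> + 1 / rt * exp (rt * (x - x\<^sub>1))"

definition right' :: "real \<Rightarrow> real" where
  "right' x = exp (rt * (x - x\<^sub>1))"

definition right'' :: "real \<Rightarrow> real" where
  "right'' x = rt * exp (rt * (x - x\<^sub>1))"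

definition V' :: "real \<Rightarrow> real" where
  "V' = glue x\<^sub>\<beta> left' (glue x\<^sub>1 (mid 1) right')"

definition V'' :: "real \<Rightarrow> real" where
  "V'' = glue x\<^sub>\<beta> left'' (glue x\<^sub>1 (mid 2) right'')"

lemma V_eq_glue: "V_fun \<mu> \<sigma> \<gamma> \<delta> M \<beta> = glue x\<^sub>\<beta> left (glue x\<^sub>1 (mid 0) right)"
  by (simp add: fun_eq_iff V_fun_def glue_def left_def mid_def right_def)

text \<open>
  The ODE for \<open>a\<close> has the factor \<open>a - c\<close>, which cancels against the base of the power, and
  \<open>\<Gamma> D = \<mu>\<^sup>2\<close>.
\<close>

lemma w_deriv:
  "((\<lambda>x. ((a x - c) / (2 * \<delta> / \<mu> - c)) powr (- \<Gamma>)) has_real_derivative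
     - \<mu> / (\<sigma>\<^sup>2 * a x) * ((a x - c) / (2 * \<delta> / \<mu> - c)) powr (- \<Gamma>)) (at x)"
proof -
  define k where "k = 2 * \<delta> / \<mu> - c"
  define w where "w = (a x - c) / k"
  have k: "k > 0" and ax: "a x - c > 0" "a x > 0"
    using c_less a_gt_c[of x] c_pos by (auto simp: k_def)
  have w: "w > 0" using k ax by (simp add: w_def)
  have "((\<lambda>x. (a x - c) / k) has_real_derivative D / (\<mu> * \<sigma>\<^sup>2) * (a x - c) / a x / k) (at x)"
    using k by (auto intro!: derivative_eq_intros a_deriv)
  from DERIV_powr[OF this w[unfolded w_def] DERIV_const, of "- \<Gamma>"]
  have "((\<lambda>x. ((a x - c) / k) powr (- \<Gamma>)) has_real_derivative
      w powr (- \<Gamma>) * (0 * ln w + D / (\<mu> * \<sigma>\<^sup>2) * (a x - c) / a x / k * (- \<Gamma>) / w)) (at x)"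
    unfolding w_def .
  moreover have "0 * ln w + D / (\<mu> * \<sigma>\<^sup>2) * (a x - c) / a x / k * (- \<Gamma>) / w = - \<mu> / (\<sigma>\<^sup>2 * a x)"
  proof -
    have "D / (\<mu> * \<sigma>\<^sup>2) * (a x - c) / a x / k * (- \<Gamma>) / w = - (\<Gamma> * D) / (\<mu> * \<sigma>\<^sup>2 * a x)"
      using k ax by (simp add: w_def mult_ac)
    moreover have "\<Gamma> * D = \<mu>\<^sup>2" using D_pos by (simp add: Gamma_exp_def)
    ultimately show ?thesis
      using mu by (simp add: power2_eq_square mult_ac)
  qed
  ultimately have "((\<lambda>x. ((a x - c) / k) powr (- \<Gamma>)) has_real_derivative
      w powr (- \<Gamma>) * (- \<mu> / (\<sigma>\<^sup>2 * a x))) (at x)"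
    by (simp only:)
  then show ?thesis unfolding k_def w_def by (simp only: mult.commute)
qed

lemma left'_deriv: "(left' has_real_derivative left'' x) (at x)"
  unfolding left'_def[abs_def] left''_def
  by (rule DERIV_cong[OF DERIV_cmult[OF w_deriv]]) simp

text \<open>
  The constants \<open>c\<close> and \<open>\<Gamma>\<close> are chosen such that the factor multiplying
  \<open>V'(0) w\<^sup>-\<^sup>\<Gamma>\<close> in the derivative is identically 1; this amounts to \<open>D c = 2 \<delta> \<mu>\<close>.
\<close>

lemma left_deriv: "(left has_real_derivative left' x) (at x)"
proof -
  define W where "W = ((a x - c) / (2 * \<delta> / \<mu> - c)) powr (- \<Gamma>)"
  have ax: "a x > 0" using a_gt_c[of x] c_pos by simp
  have 1: "((\<lambda>x. V\<^sub>0 * ((\<mu> * a x - 2 * \<delta>) / (2 * \<gamma>))) has_real_derivative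
      V\<^sub>0 * (\<mu> * (D / (\<mu> * \<sigma>\<^sup>2) * (a x - c) / a x) / (2 * \<gamma>))) (at x)"
    using gamma by (auto intro!: derivative_eq_intros a_deriv simp: mult_ac)
  have key: "D * (a x - c) - \<mu> * (\<mu> * a x - 2 * \<delta>) = 2 * \<gamma> * \<sigma>\<^sup>2 * a x"
  proof -
    have "D * c = 2 * \<delta> * \<mu>" using D_pos by (simp add: c_const_def)
    moreover have "D * (a x - c) = D * a x - D * c" by (rule right_diff_distrib)
    ultimately show ?thesis by (simp add: power2_eq_square algebra_simps)
  qed
  have "\<mu> * (D / (\<mu> * \<sigma>\<^sup>2) * y / A) / (2 * \<gamma>) + n / (2 * \<gamma>) * (- \<mu> / (\<sigma>\<^sup>2 * A))
      = (D * y - \<mu> * n) / (2 * \<gamma> * \<sigma>\<^sup>2 * A)" for y n A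
    using mu by (simp add: diff_divide_distrib mult_ac)
  then have "\<mu> * (D / (\<mu> * \<sigma>\<^sup>2) * (a x - c) / a x) / (2 * \<gamma>)
        + (\<mu> * a x - 2 * \<delta>) / (2 * \<gamma>) * (- \<mu> / (\<sigma>\<^sup>2 * a x))
      = (D * (a x - c) - \<mu> * (\<mu> * a x - 2 * \<delta>)) / (2 * \<gamma> * \<sigma>\<^sup>2 * a x)" .
  also have "\<dots> = 1"
    unfolding key using ax gamma sigma by simp
  finally have e: "\<mu> * (D / (\<mu> * \<sigma>\<^sup>2) * (a x - c) / a x) / (2 * \<gamma>)
        + (\<mu> * a x - 2 * \<delta>) / (2 * \<gamma>) * (- \<mu> / (\<sigma>\<^sup>2 * a x)) = 1" .
  have "V\<^sub>0 * p * W + - \<mu> / (\<sigma>\<^sup>2 * a x) * W * (V\<^sub>0 * q)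
     = V\<^sub>0 * W * (p + q * (- \<mu> / (\<sigma>\<^sup>2 * a x)))" for p q
    by (simp add: algebra_simps)
  note e' = this[of "\<mu> * (D / (\<mu> * \<sigma>\<^sup>2) * (a x - c) / a x) / (2 * \<gamma>)"
      "(\<mu> * a x - 2 * \<delta>) / (2 * \<gamma>)", unfolded e]
  show ?thesis
    unfolding left_def[abs_def] left'_def
    by (rule DERIV_cong[OF DERIV_mult[OF 1 w_deriv]]) (use e' in \<open>simp only: W_def mult_1_right\<close>)
qed

lemma mid_deriv: "(mid n has_real_derivative mid (Suc n) x) (at x)"
  unfolding mid_def[abs_def] by (auto intro!: derivative_eq_intros simp: algebra_simps)

lemma right_deriv: "(right has_real_derivative right' x) (at x)"
  unfolding right_def[abs_def] right'_def using r_signs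
  by (auto intro!: derivative_eq_intros)

lemma right'_deriv: "(right' has_real_derivative right'' x) (at x)"
  unfolding right'_def[abs_def] right''_def
  by (auto intro!: derivative_eq_intros)

text \<open>
  This is the HJB equation at its vertex: inserting \<open>\<sigma>\<^sup>2 a V'' = - \<mu> V'\<close> turns the quadratic into
  \<open>(\<mu> a / 2 - \<delta>) V' - \<gamma> V\<close>.
\<close>

lemma left_ode: "\<gamma> * left x = (\<mu> * a x / 2 - \<delta>) * left' x"
  using gamma by (simp add: left_def left'_def field_simps)

lemma mid_ode: "1/2 * \<sigma>\<^sup>2 * \<beta>\<^sup>2 * mid 2 x + (\<beta> * \<mu> - \<delta>) * mid 1 x - \<gamma> * mid 0 x = 0"
proof -
  have "1/2 * \<sigma>\<^sup>2 * \<beta>\<^sup>2 * mid 2 x + (\<beta> * \<mu> - \<delta>) * mid 1 x - \<gamma> * mid 0 x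
    = (1/2 * \<sigma>\<^sup>2 * \<beta>\<^sup>2 * rp\<^sup>2 + (\<beta> * \<mu> - \<delta>) * rp - \<gamma>) * (k\<^sub>1 * exp (rp * (x - x\<^sub>1)))
    + (1/2 * \<sigma>\<^sup>2 * \<beta>\<^sup>2 * rm\<^sup>2 + (\<beta> * \<mu> - \<delta>) * rm - \<gamma>) * (k\<^sub>2 * exp (rm * (x - x\<^sub>1)))"
    unfolding mid_def by (simp add: algebra_simps)
  then show ?thesis unfolding rp_root rm_root by simp
qed

text \<open>
  The constant \<open>M / \<gamma>\<close> absorbs the inhomogeneity \<open>M\<close>; what is left is the characteristic equation
  of \<open>rt\<close>.
\<close>

lemma right_ode:
  "1/2 * \<sigma>\<^sup>2 * \<beta>\<^sup>2 * right'' x + (\<beta> * \<mu> - \<delta>) * right' x - \<gamma> * right x + M * (1 - right' x) = 0"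
proof -
  define e where "e = exp (rt * (x - x\<^sub>1))"
  have "rt * (1/2 * \<sigma>\<^sup>2 * \<beta>\<^sup>2 * (rt * e) + (\<beta> * \<mu> - \<delta>) * e
        - \<gamma> * (M / \<gamma> + 1 / rt * e) + M * (1 - e))
      = (1/2 * \<sigma>\<^sup>2 * \<beta>\<^sup>2 * rt\<^sup>2 + (\<beta> * \<mu> - (\<delta> + M)) * rt - \<gamma>) * e"
    using r_signs gamma by (simp add: algebra_simps power2_eq_square)
  also have "\<dots> = 0" unfolding rt_root by simp
  finally show ?thesis
    using r_signs by (simp add: right_def right'_def right''_def e_def)
qed

subsection \<open>Smooth fit\<close>

lemma mid_Suc: "mid (Suc n) x = (rt - rm) / (rp - rm) * rp ^ n * exp (rp * (x - x\<^sub>1))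
    + (rp - rt) / (rp - rm) * rm ^ n * exp (rm * (x - x\<^sub>1))"
  unfolding mid_def k1_rp[symmetric] k2_rm[symmetric] by simp

lemma mid1_x1: "mid 1 x\<^sub>1 = 1"
proof -
  have "mid 1 x\<^sub>1 = (rt - rm) / (rp - rm) + (rp - rt) / (rp - rm)"
    using mid_Suc[of 0 "x\<^sub>1"] by simp
  also have "\<dots> = ((rt - rm) + (rp - rt)) / (rp - rm)"
    by (rule add_divide_distrib[symmetric])
  also have "(rt - rm) + (rp - rt) = rp - rm" by simp
  finally show ?thesis using r_signs by simp
qed

lemma mid2_x1: "mid 2 x\<^sub>1 = rt"
proof -
  have "mid 2 x\<^sub>1 = ((rt - rm) * rp + (rp - rt) * rm) / (rp - rm)"
    using mid_Suc[of 1 "x\<^sub>1"] by (simp add: add_divide_distrib numeral_2_eq_2)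
  also have "(rt - rm) * rp + (rp - rt) * rm = rt * (rp - rm)" by (simp add: algebra_simps)
  finally show ?thesis using r_signs by simp
qed

text \<open>
  Given that the first two derivatives agree and \<open>V' = 1\<close>, the two linear equations coincide at the
  junction and force the values to agree.
\<close>

lemma fit_x1: "mid 1 x\<^sub>1 = right' x\<^sub>1" "mid 2 x\<^sub>1 = right'' x\<^sub>1" "mid 0 x\<^sub>1 = right x\<^sub>1"
proof -
  show 1: "mid 1 x\<^sub>1 = right' x\<^sub>1" and 2: "mid 2 x\<^sub>1 = right'' x\<^sub>1"
    unfolding mid1_x1 mid2_x1 right'_def right''_def by simp_all
  have "right' x\<^sub>1 = 1" by (simp add: right'_def)
  then have "\<gamma> * mid 0 x\<^sub>1 = \<gamma> * right x\<^sub>1"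
    using mid_ode[of "x\<^sub>1"] right_ode[of "x\<^sub>1"] unfolding 1 2 by simp
  then show "mid 0 x\<^sub>1 = right x\<^sub>1" using gamma by simp
qed

text \<open>
  The sign of \<open>\<mu> V' + \<beta> \<sigma>\<^sup>2 V''\<close> tells on which side of \<open>\<beta>\<close> the vertex lies. On the middle
  piece this is a combination of two exponentials with coefficients of opposite signs; factoring out
  the decaying one exhibits a single zero, at distance \<open>\<Delta>\<close> from \<open>x\<^sub>1\<close>.
\<close>

lemma mid_slope_eq:
  "\<mu> * mid 1 x + \<beta> * \<sigma>\<^sup>2 * mid 2 x
    = (rt - rm) * (\<mu> + \<beta> * \<sigma>\<^sup>2 * rp) / (rp - rm) * exp (rm * (x - x\<^sub>1))
      * (exp ((rp - rm) * (x - x\<^sub>1)) - exp ((rp - rm) * \<Delta>))"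
proof -
  define A where "A = (rt - rm) * (\<mu> + \<beta> * \<sigma>\<^sup>2 * rp)"
  define E where "E = exp (rm * (x - x\<^sub>1))"
  define F where "F = exp ((rp - rm) * (x - x\<^sub>1))"
  have F: "exp (rp * (x - x\<^sub>1)) = E * F"
    unfolding E_def F_def exp_add[symmetric] by (simp add: algebra_simps)
  define p q where "p = (rt - rm) / (rp - rm)" and "q = (rp - rt) / (rp - rm)"
  have m: "mid 1 x = p * (E * F) + q * E" "mid 2 x = p * rp * (E * F) + q * rm * E"
    using mid_Suc[of 0 x] mid_Suc[of 1 x] unfolding F E_def[symmetric] p_def q_def
    by (simp_all add: numeral_2_eq_2)
  have "\<mu> * mid 1 x + \<beta> * \<sigma>\<^sup>2 * mid 2 x
      = p * (\<mu> + \<beta> * \<sigma>\<^sup>2 * rp) * (E * F) + q * (\<mu> + \<beta> * \<sigma>\<^sup>2 * rm) * E"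
    unfolding m by (simp add: algebra_simps)
  also have "\<dots> = (A * (E * F) + (rp - rt) * (\<mu> + \<beta> * \<sigma>\<^sup>2 * rm) * E) / (rp - rm)"
    by (simp add: p_def q_def A_def add_divide_distrib)
  also have "(rp - rt) * (\<mu> + \<beta> * \<sigma>\<^sup>2 * rm) = - (A * exp ((rp - rm) * \<Delta>))"
    unfolding A_def exp_Delta by simp
  also have "(A * (E * F) + - (A * exp ((rp - rm) * \<Delta>)) * E) / (rp - rm)
      = A / (rp - rm) * E * (F - exp ((rp - rm) * \<Delta>))"
    by (simp add: field_simps)
  finally show ?thesis unfolding A_def E_def F_def .
qed

lemma mid_slope_nonneg:
  assumes "x\<^sub>\<beta> \<le> x"
  shows "\<mu> * mid 1 x + \<beta> * \<sigma>\<^sup>2 * mid 2 x \<ge> 0"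
  unfolding mid_slope_eq
proof (intro mult_nonneg_nonneg divide_nonneg_nonneg)
  have "\<Delta> \<le> x - x\<^sub>1" using assms by (simp add: x_one_def)
  then show "0 \<le> exp ((rp - rm) * (x - x\<^sub>1)) - exp ((rp - rm) * \<Delta>)"
    using r_signs by (simp add: mult_left_mono)
qed (use rt_between slope_rp in auto)

lemma mid_slope_xb: "\<mu> * mid 1 x\<^sub>\<beta> + \<beta> * \<sigma>\<^sup>2 * mid 2 x\<^sub>\<beta> = 0"
  unfolding mid_slope_eq by (simp add: x_one_def)

text \<open>
  After division by \<open>exp (rm (x - x\<^sub>1))\<close>, the second derivative is increasing in \<open>x\<close>, and at \<open>x\<^sub>1\<close>
  it is \<open>rt < 0\<close>.
\<close>

lemma mid2_neg:
  assumes "x \<le> x\<^sub>1"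
  shows "mid 2 x < 0"
proof -
  define E where "E = exp (rm * (x - x\<^sub>1))"
  define F where "F = exp ((rp - rm) * (x - x\<^sub>1))"
  define d where "d = rp - rm"
  have d: "d > 0" using r_signs by (simp add: d_def)
  have F: "exp (rp * (x - x\<^sub>1)) = E * F"
    unfolding E_def F_def exp_add[symmetric] by (simp add: algebra_simps)
  have "(rp - rm) * (x - x\<^sub>1) \<le> 0"
    using assms r_signs by (intro mult_nonneg_nonpos) auto
  then have "F \<le> 1" unfolding F_def by simp
  then have "(rt - rm) / d * rp * F \<le> (rt - rm) / d * rp * 1"
    using rt_between r_signs d by (intro mult_left_mono) auto
  moreover have "(rt - rm) / d * rp * 1 + (rp - rt) / d * rm = rt"
    using mid2_x1 mid_Suc[of 1 "x\<^sub>1"] by (simp add: numeral_2_eq_2 d_def)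
  ultimately have "(rt - rm) / d * rp * F + (rp - rt) / d * rm < 0"
    using r_signs by linarith
  then have "E * ((rt - rm) / d * rp * F + (rp - rt) / d * rm) < 0"
    by (intro mult_pos_neg) (auto simp: E_def)
  then show ?thesis
    using mid_Suc[of 1 x] unfolding F E_def[symmetric] d_def[symmetric]
    by (simp add: numeral_2_eq_2 algebra_simps)
qed

lemma mid1_ge_1:
  assumes "x \<le> x\<^sub>1"
  shows "mid 1 x \<ge> 1"
proof -
  have "mid 1 x\<^sub>1 \<le> mid 1 x"
    using assms
  proof (rule DERIV_nonpos_imp_nonincreasing)
    show "\<exists>y. (mid 1 has_real_derivative y) (at z) \<and> y \<le> 0" if "x \<le> z" "z \<le> x\<^sub>1" for z
      using mid_deriv[of 1 z] mid2_neg[OF that(2)] by (auto simp: numeral_2_eq_2)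
  qed
  then show ?thesis unfolding mid1_x1 .
qed

text \<open>
  The vertex is \<open>\<beta>\<close> at \<open>x\<^sub>\<beta>\<close>, so there the middle piece satisfies the relation of
  \<open>left_ode\<close> with \<open>a = \<beta>\<close>.
\<close>

lemma mid0_xb: "\<gamma> * mid 0 x\<^sub>\<beta> = (\<mu> * \<beta> / 2 - \<delta>) * mid 1 x\<^sub>\<beta>"
proof -
  have "\<beta> / 2 * (\<mu> * mid 1 x\<^sub>\<beta> + \<beta> * \<sigma>\<^sup>2 * mid 2 x\<^sub>\<beta>) = 0"
    unfolding mid_slope_xb by simp
  then show ?thesis
    using mid_ode[of "x\<^sub>\<beta>"] by (simp add: algebra_simps power2_eq_square)
qed

text \<open>
  \<open>V'(0)\<close> is defined by matching values at \<open>x\<^sub>\<beta>\<close>; by \<open>mid0_xb\<close> this is the same as matching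
  first derivatives.
\<close>

lemma V0_eq: "V\<^sub>0 = mid 1 x\<^sub>\<beta> * ((\<beta> - c) / (2 * \<delta> / \<mu> - c)) powr \<Gamma>"
proof -
  have pos: "\<mu> * \<beta> - 2 * \<delta> > 0" using beta mu by (simp add: field_simps)
  have "V\<^sub>0 = 2 * \<gamma> / (\<mu> * \<beta> - 2 * \<delta>) * mid 0 x\<^sub>\<beta> * ((\<beta> - c) / (2 * \<delta> / \<mu> - c)) powr \<Gamma>"
    by (simp add: V_prime0_def mid_def x_one_def)
  also have "2 * \<gamma> / (\<mu> * \<beta> - 2 * \<delta>) * mid 0 x\<^sub>\<beta> = mid 1 x\<^sub>\<beta>"
    using mid0_xb pos by (simp add: field_simps)
  finally show ?thesis .
qed

lemma V0_pos: "V\<^sub>0 > 0"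
  using mid1_ge_1[OF xb_le_x1] c_less c_less_beta by (simp add: V0_eq)

lemma fit_xb: "left' x\<^sub>\<beta> = mid 1 x\<^sub>\<beta>" "left'' x\<^sub>\<beta> = mid 2 x\<^sub>\<beta>" "left x\<^sub>\<beta> = mid 0 x\<^sub>\<beta>"
proof -
  show 1: "left' x\<^sub>\<beta> = mid 1 x\<^sub>\<beta>"
    using c_less c_less_beta
    by (simp add: left'_def a_xb V0_eq powr_minus)
  have "\<gamma> * left x\<^sub>\<beta> = \<gamma> * mid 0 x\<^sub>\<beta>"
    unfolding left_ode mid0_xb a_xb 1 ..
  then show "left x\<^sub>\<beta> = mid 0 x\<^sub>\<beta>" using gamma by simp
  show "left'' x\<^sub>\<beta> = mid 2 x\<^sub>\<beta>"
    unfolding left''_def 1 a_xb using mid_slope_xb beta_pos sigma by (simp add: field_simps)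
qed

text \<open>
  If \<open>x\<^sub>\<beta> = x\<^sub>1\<close>, the middle interval is empty and the left piece meets the right one directly;
  the fit at \<open>x\<^sub>1\<close> covers this case.
\<close>

lemma glue_at_xb:
  assumes "f x\<^sub>\<beta> = g x\<^sub>\<beta>" "g x\<^sub>1 = h x\<^sub>1"
  shows "f x\<^sub>\<beta> = glue x\<^sub>1 g h x\<^sub>\<beta>"
  using assms xb_le_x1 by (auto simp: glue_def)

lemma V_deriv: "(V_fun \<mu> \<sigma> \<gamma> \<delta> M \<beta> has_real_derivative V' x) (at x)"
  unfolding V_eq_glue V'_def
  by (intro has_real_derivative_glue left_deriv right_deriv glue_at_xb fit_x1 fit_xb)
     (use mid_deriv[of 0] in simp)

lemma V'_deriv: "(V' has_real_derivative V'' x) (at x)"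
  unfolding V'_def V''_def
  by (intro has_real_derivative_glue left'_deriv right'_deriv glue_at_xb fit_x1 fit_xb)
     (use mid_deriv[of 1] in \<open>simp add: numeral_2_eq_2\<close>)

lemma V''_continuous: "continuous_on UNIV V''"
  unfolding V''_def
proof (intro continuous_on_glue glue_at_xb fit_x1 fit_xb)
  have "a x \<noteq> 0" for x using a_gt_c[of x] c_pos by simp
  moreover have "continuous_on UNIV left'" "continuous_on UNIV a"
    using left'_deriv a_deriv by (metis DERIV_isCont continuous_at_imp_continuous_on)+
  ultimately show "continuous_on UNIV left''"
    unfolding left''_def[abs_def] by (intro continuous_intros) auto
  show "continuous_on UNIV (mid 2)"
    using mid_deriv by (metis DERIV_isCont continuous_at_imp_continuous_on)
  show "continuous_on UNIV right''"
    unfolding right''_def[abs_def] by (intro continuous_intros)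
qed

subsection \<open>Shape of the value function\<close>

lemma left'_pos: "left' x > 0"
  using V0_pos a_gt_c[of x] c_less by (simp add: left'_def)

lemma V''_nonpos: "V'' x \<le> 0"
proof -
  have "left'' x \<le> 0"
    using left'_pos[of x] a_gt_c[of x] c_pos mu sigma
    by (simp add: left''_def divide_nonpos_pos)
  moreover have "right'' x \<le> 0"
    using r_signs by (simp add: right''_def mult_nonpos_nonneg)
  ultimately show ?thesis
    using mid2_neg[of x] by (auto simp: V''_def glue_def)
qed

lemma V'_antimono:
  assumes "x \<le> y"
  shows "V' y \<le> V' x"
  using assms by (rule DERIV_nonpos_imp_nonincreasing) (use V'_deriv V''_nonpos in blast)

lemma V'_x1: "V' x\<^sub>1 = 1"
  using xb_le_x1 by (simp add: V'_def glue_def right'_def)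

lemma V'_pos: "V' x > 0"
  using left'_pos[of x] mid1_ge_1[of x] by (auto simp: V'_def glue_def right'_def)

lemma V_mono:
  assumes "x \<le> y"
  shows "V_fun \<mu> \<sigma> \<gamma> \<delta> M \<beta> x \<le> V_fun \<mu> \<sigma> \<gamma> \<delta> M \<beta> y"
  using assms by (rule DERIV_nonneg_imp_nondecreasing) (use V_deriv V'_pos less_imp_le in blast)

lemma V_0: "V_fun \<mu> \<sigma> \<gamma> \<delta> M \<beta> 0 = 0"
  using xb_pos mu by (simp add: V_eq_glue glue_def left_def a_0)

text \<open>Since \<open>V\<close> increases, it suffices to look at the right piece, where \<open>rt < 0\<close>.\<close>

lemma V_le: "V_fun \<mu> \<sigma> \<gamma> \<delta> M \<beta> x \<le> M / \<gamma>"
proof -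
  have "V_fun \<mu> \<sigma> \<gamma> \<delta> M \<beta> x \<le> V_fun \<mu> \<sigma> \<gamma> \<delta> M \<beta> (max x x\<^sub>1)" by (rule V_mono) simp
  also have "\<dots> = right (max x x\<^sub>1)" using xb_le_x1 by (auto simp: V_eq_glue glue_def)
  also have "\<dots> \<le> M / \<gamma>" using r_signs by (simp add: right_def divide_nonneg_neg)
  finally show ?thesis .
qed

lemma V_concave: "concave_on UNIV (V_fun \<mu> \<sigma> \<gamma> \<delta> M \<beta>)"
  by (rule f''_le0_imp_concave[where f' = V' and f'' = V''])
     (auto intro: V_deriv V'_deriv V''_nonpos)

subsection \<open>The HJB equation\<close>

lemma HJB_left:
  assumes "0 \<le> x" "x < x\<^sub>\<beta>" "\<alpha> \<le> 2 * \<delta> / \<mu>"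
  shows "is_max_over 0 (\<lambda>s. 1 / 2 * \<sigma>\<^sup>2 * s\<^sup>2 * V'' x + (s * \<mu> - \<delta>) * V' x
    + (M * max (1 - V' x) 0 - \<gamma> * V_fun \<mu> \<sigma> \<gamma> \<delta> M \<beta> x)) {\<alpha>..\<beta>}"
proof (rule hjb_max_at[where s = "a x"])
  show "a x \<in> {\<alpha>..\<beta>}" using a_mono[of 0 x] a_mono[of x "x\<^sub>\<beta>"] assms by (simp add: a_0 a_xb)
  have ax: "a x > 0" using a_gt_c[of x] c_pos by simp
  have V: "V' x = left' x" "V'' x = left'' x" "V_fun \<mu> \<sigma> \<gamma> \<delta> M \<beta> x = left x"
    using assms by (auto simp: V'_def V''_def V_eq_glue glue_def)
  \<comment> \<open>First-order condition: \<open>a x\<close> is the vertex.\<close>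
  have foc: "\<mu> * V' x + a x * \<sigma>\<^sup>2 * V'' x = 0"
    unfolding V left''_def using ax sigma by simp
  then show "(s - a x) * (\<mu> * V' x + a x * \<sigma>\<^sup>2 * V'' x) \<le> 0" for s by simp
  have "1 \<le> V' x" using V'_antimono[of x "x\<^sub>1"] assms xb_le_x1 by (simp add: V'_x1)
  then have m: "max (1 - V' x) 0 = 0" by simp
  have "a x / 2 * (\<mu> * V' x + a x * \<sigma>\<^sup>2 * V'' x) = 0" unfolding foc by simp
  then show "1 / 2 * \<sigma>\<^sup>2 * (a x)\<^sup>2 * V'' x + (a x * \<mu> - \<delta>) * V' x
    + (M * max (1 - V' x) 0 - \<gamma> * V_fun \<mu> \<sigma> \<gamma> \<delta> M \<beta> x) = 0"
    unfolding m unfolding V left_ode by (simp add: algebra_simps power2_eq_square)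
qed (rule V''_nonpos)

text \<open>
  On the middle and the right piece the slope of the quadratic at \<open>\<beta>\<close> is nonnegative, by \<open>mid_slope_nonneg\<close>
  before \<open>x\<^sub>1\<close> and by \<open>slope_rt\<close> after it, so \<open>\<beta>\<close> is the maximiser.
\<close>

lemma HJB_beyond:
  assumes "x\<^sub>\<beta> \<le> x" "\<alpha> < \<beta>"
  shows "is_max_over 0 (\<lambda>s. 1 / 2 * \<sigma>\<^sup>2 * s\<^sup>2 * V'' x + (s * \<mu> - \<delta>) * V' x
    + (M * max (1 - V' x) 0 - \<gamma> * V_fun \<mu> \<sigma> \<gamma> \<delta> M \<beta> x)) {\<alpha>..\<beta>}"
proof (rule hjb_max_at[where s = \<beta>])
  have "\<mu> * V' x + \<beta> * \<sigma>\<^sup>2 * V'' x \<ge> 0"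
  proof (cases "x < x\<^sub>1")
    case True
    then show ?thesis using mid_slope_nonneg assms by (simp add: V'_def V''_def glue_def)
  next
    case False
    have "\<mu> * right' x + \<beta> * \<sigma>\<^sup>2 * right'' x = (\<mu> + \<beta> * \<sigma>\<^sup>2 * rt) * exp (rt * (x - x\<^sub>1))"
      by (simp add: right'_def right''_def algebra_simps)
    then show ?thesis using False slope_rt assms by (simp add: V'_def V''_def glue_def)
  qed
  then show "(s - \<beta>) * (\<mu> * V' x + \<beta> * \<sigma>\<^sup>2 * V'' x) \<le> 0" if "s \<in> {\<alpha>..\<beta>}" for s
    using that by (intro mult_nonpos_nonneg) auto
  show "1 / 2 * \<sigma>\<^sup>2 * \<beta>\<^sup>2 * V'' x + (\<beta> * \<mu> - \<delta>) * V' x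
    + (M * max (1 - V' x) 0 - \<gamma> * V_fun \<mu> \<sigma> \<gamma> \<delta> M \<beta> x) = 0"
  proof (cases "x < x\<^sub>1")
    case True
    then have "1 \<le> V' x" using V'_antimono[of x "x\<^sub>1"] by (simp add: V'_x1)
    then show ?thesis
      using True assms mid_ode[of x] by (simp add: V'_def V''_def V_eq_glue glue_def)
  next
    case False
    then have "V' x \<le> 1" using V'_antimono[of "x\<^sub>1" x] by (simp add: V'_x1)
    then show ?thesis
      using False assms right_ode[of x] by (simp add: V'_def V''_def V_eq_glue glue_def)
  qed
qed (use assms V''_nonpos in auto)

lemma V_HJB:
  assumes "\<alpha> \<le> 2 * \<delta> / \<mu>" "\<alpha> < \<beta>"
  shows "HJB_solution \<mu> \<sigma> \<gamma> \<delta> M \<alpha> \<beta> (V_fun \<mu> \<sigma> \<gamma> \<delta> M \<beta>) V' V''"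
  unfolding HJB_solution_def
proof (intro conjI allI impI V_0)
  fix x :: real assume "0 \<le> x"
  then have "is_max_over 0 (\<lambda>s. 1 / 2 * \<sigma>\<^sup>2 * s\<^sup>2 * V'' x + (s * \<mu> - \<delta>) * V' x
    + (M * max (1 - V' x) 0 - \<gamma> * V_fun \<mu> \<sigma> \<gamma> \<delta> M \<beta> x)) {\<alpha>..\<beta>}"
    using HJB_left HJB_beyond assms by (cases "x < x\<^sub>\<beta>") auto
  then show "is_max_over 0 (\<lambda>s. 1 / 2 * \<sigma>\<^sup>2 * s\<^sup>2 * V'' x + (s * \<mu> - \<delta>) * V' x
    - \<gamma> * V_fun \<mu> \<sigma> \<gamma> \<delta> M \<beta> x + M * max (1 - V' x) 0) {\<alpha>..\<beta>}"
    by (simp add: algebra_simps)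
qed

lemma V_C2: "C2_on_with (V_fun \<mu> \<sigma> \<gamma> \<delta> M \<beta>) V' V'' S"
  unfolding C2_on_with_def
  by (auto intro: has_field_derivative_at_within V_deriv V'_deriv continuous_on_subset V''_continuous)

end

section \<open>The verification theorem\<close>

theorem theorem3p13:
  fixes \<mu> \<sigma> \<gamma> \<delta> M \<alpha> \<beta> :: real
  assumes "\<mu> > 0" and "\<sigma> > 0" and "\<gamma> > 0" and "\<delta> \<ge> 0" and "M > 0"
    and "0 < \<alpha>" and "\<alpha> < \<beta>"
    and "\<alpha> \<le> 2 * \<delta> / \<mu>" and "2 * \<delta> / \<mu> < \<beta>"
    and "M \<ge> M_thr \<mu> \<sigma> \<gamma> \<delta> \<beta>"
  shows "concave_on {0..} (V_fun \<mu> \<sigma> \<gamma> \<delta> M \<beta>) \<and>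
         (\<exists>V1 V2. C2_on_with (V_fun \<mu> \<sigma> \<gamma> \<delta> M \<beta>) V1 V2 {0..} \<and>
                  HJB_solution \<mu> \<sigma> \<gamma> \<delta> M \<alpha> \<beta> (V_fun \<mu> \<sigma> \<gamma> \<delta> M \<beta>) V1 V2) \<and>
         (\<forall>x>0. 0 \<le> V_fun \<mu> \<sigma> \<gamma> \<delta> M \<beta> x \<and> V_fun \<mu> \<sigma> \<gamma> \<delta> M \<beta> x \<le> M / \<gamma>)"
proof -
  \<comment> \<open>\<open>\<delta> = 0\<close> would contradict \<open>0 < \<alpha> \<le> 2 \<delta> / \<mu>\<close>.\<close>
  have "\<delta> \<noteq> 0" using assms by auto
  then interpret dividend_model \<mu> \<sigma> \<gamma> \<delta> M \<beta>
    using assms by unfold_locales auto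
  have "concave_on {0..} (V_fun \<mu> \<sigma> \<gamma> \<delta> M \<beta>)"
    using V_concave convex_on_subset unfolding concave_on_def by blast
  moreover have "0 \<le> V_fun \<mu> \<sigma> \<gamma> \<delta> M \<beta> x" if "x > 0" for x
    using V_mono[of 0 x] that by (simp add: V_0)
  ultimately show ?thesis
    using V_C2 V_HJB assms V_le by blast
qed

end
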